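(* Let $\nu$ be a positive Borel measure on $\mathbb{R}^d$ with $\int(1\wedge|x|)\,\nu(\mathrm{d}x)<\infty$ and $\nu(\{0\})=0$. For $u\in L^1(\mathbb{R}^d)$ and $t\in\mathbb{R}$ set $S_t(u)=\{x\in\mathbb{R}^d:u(x)>t\}$. Then $$\mathcal{F}_\nu(u)=\int_{\mathbb{R}}\mathrm{Per}_\nu(S_t(u))\,\mathrm{d}t.$$
   Context: $a\wedge b=\min(a,b)$. $\mathcal{F}_\nu(u)=\frac12\int_{\mathbb{R}^d}\int_{\mathbb{R}^d}|u(x+y)-u(y)|\,\nu(\mathrm{d}x)\,\mathrm{d}y\in[0,\infty]$, and for a Borel set $E\subset\mathbb{R}^d$, $\mathrm{Per}_\nu(E)=\int_E\int_{E^c-x}\nu(\mathrm{d}y)\,\mathrm{d}x=\int_E\nu(E^c-x)\,\mathrm{d}x\in[0,\infty]$. *)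

theory Defs
  imports "HOL-Analysis.Analysis"
begin

definition nl_variation :: "(real ^ 'd) measure \<Rightarrow> (real ^ 'd \<Rightarrow> real) \<Rightarrow> ennreal" where
  "nl_variation \<nu> u =
     ennreal (1 / 2) * (\<integral>\<^sup>+ y. (\<integral>\<^sup>+ x. ennreal \<bar>u (x + y) - u y\<bar> \<partial>\<nu>) \<partial>lborel)"

definition nl_perimeter :: "(real ^ 'd) measure \<Rightarrow> (real ^ 'd) set \<Rightarrow> ennreal" where
  "nl_perimeter \<nu> E = (\<integral>\<^sup>+ x\<in>E. emeasure \<nu> {z - x | z. z \<in> - E} \<partial>lborel)"

definition superlevel :: "(real ^ 'd \<Rightarrow> real) \<Rightarrow> real \<Rightarrow> (real ^ 'd) set" where
  "superlevel u t = {x. u x > t}"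

end

theory Submission imports Defs begin

text \<open>
  Writing the positive part \<open>(a - b)\<^sup>+\<close> as the length of \<open>{b..<a}\<close> and using Tonelli, the integral
  of the perimeters becomes \<open>\<integral>\<integral> (u y - u (x + y))\<^sup>+ \<nu>(dx) dy\<close>. Since \<open>\<nu>\<close> need not be symmetric,
  the factor \<open>1/2\<close> comes from translation invariance of Lebesgue measure instead: for each fixed \<open>x\<close> the
  function \<open>y \<mapsto> u y - u (x + y)\<close> is integrable with integral \<open>0\<close>, so its positive and negative
  parts have the same integral.
\<close>

text \<open>\<open>ennreal\<close> sends negative reals to \<open>0\<close>, so the two sides
  integrate the positive and the negative part of \<open>f - g\<close>. Both are finite by
  integrability, and their difference is the integral of \<open>f - g\<close>, which vanishes by
  \<open>eq\<close>.\<close>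

lemma nn_integral_diff_commute:
  fixes f g :: "'a \<Rightarrow> real"
  assumes f: "integrable M f" and g: "integrable M g"
    and eq: "integral\<^sup>L M f = integral\<^sup>L M g"
  shows "(\<integral>\<^sup>+ x. ennreal (f x - g x) \<partial>M) = (\<integral>\<^sup>+ x. ennreal (g x - f x) \<partial>M)"
proof -
  have i: "integrable M (\<lambda>x. max 0 (f x - g x))" "integrable M (\<lambda>x. max 0 (g x - f x))"
    using f g by auto
  have "integral\<^sup>L M (\<lambda>x. max 0 (f x - g x)) - integral\<^sup>L M (\<lambda>x. max 0 (g x - f x))
      = integral\<^sup>L M (\<lambda>x. max 0 (f x - g x) - max 0 (g x - f x))"
    using i by simp
  also have "\<dots> = integral\<^sup>L M (\<lambda>x. f x - g x)"
    by (intro Bochner_Integration.integral_cong) auto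
  also have "\<dots> = 0"
    using f g eq by simp
  finally have "integral\<^sup>L M (\<lambda>x. max 0 (f x - g x)) = integral\<^sup>L M (\<lambda>x. max 0 (g x - f x))"
    by simp
  then have "(\<integral>\<^sup>+ x. ennreal (max 0 (f x - g x)) \<partial>M) = (\<integral>\<^sup>+ x. ennreal (max 0 (g x - f x)) \<partial>M)"
    using i by (simp add: nn_integral_eq_integral)
  then show ?thesis
    by (simp add: ennreal_max_0)
qed

lemma nn_integral_translation_diff_commute:
  fixes u :: "'a::euclidean_space \<Rightarrow> real"
  assumes "integrable lborel u"
  shows "(\<integral>\<^sup>+ y. ennreal (u y - u (x + y)) \<partial>lborel) = (\<integral>\<^sup>+ y. ennreal (u (x + y) - u y) \<partial>lborel)"
proof (rule nn_integral_diff_commute)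
  have m: "u \<in> borel_measurable borel"
    using assms by (auto dest: borel_measurable_integrable)
  have d: "distr lborel borel ((+) x) = lborel"
    by (simp add: lborel_distr_plus)
  show "integrable lborel u" by fact
  show "integrable lborel (\<lambda>y. u (x + y))"
    using integrable_distr_eq[of "(+) x" lborel borel u] m assms d by simp
  show "integral\<^sup>L lborel u = integral\<^sup>L lborel (\<lambda>y. u (x + y))"
    using integral_distr[of "(+) x" lborel borel u] m d by simp
qed

text \<open>Tonelli with respect to \<open>\<nu>\<close> needs sigma-finiteness. A Chebyshev bound
  makes the complement of every ball around the origin have finite measure; these complements
  exhaust everything but the origin, which is a null set.\<close>

lemma sigma_finite_if_min_norm_integrable:
  fixes \<nu> :: "'a::euclidean_space measure"
  assumes sets: "sets \<nu> = sets borel"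
    and fin: "(\<integral>\<^sup>+ x. ennreal (min 1 (norm x)) \<partial>\<nu>) < \<infinity>"
    and zero: "emeasure \<nu> {0} = 0"
  shows "sigma_finite_measure \<nu>"
proof
  define A where "A = (\<lambda>n. {x :: 'a. 1 / real (Suc n) \<le> norm x})"
  have sp: "space \<nu> = UNIV"
    using sets_eq_imp_space_eq[OF sets] by simp
  have meas: "A n \<in> sets \<nu>" for n
    unfolding sets A_def by measurable
  have A_fin: "emeasure \<nu> (A n) < \<infinity>" for n
  proof -
    have "emeasure \<nu> (A n) = (\<integral>\<^sup>+ x. indicator (A n) x \<partial>\<nu>)"
      using meas by simp
    also have "\<dots> \<le> (\<integral>\<^sup>+ x. ennreal (real (Suc n)) * ennreal (min 1 (norm x)) \<partial>\<nu>)"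
    proof (intro nn_integral_mono)
      fix x
      \<comment> \<open>The factor \<open>Suc n\<close> is the reciprocal of the radius defining
        \<open>A n\<close>; that radius is at most \<open>1\<close>, so the truncation at
        \<open>1\<close> does no harm.\<close>
      have "1 \<le> real (Suc n) * min 1 (norm x)" if "x \<in> A n"
        using that by (auto simp: A_def min_def field_simps)
      then show "indicator (A n) x \<le> ennreal (real (Suc n)) * ennreal (min 1 (norm x))"
        by (auto simp: indicator_def simp flip: ennreal_mult simp del: of_nat_Suc)
    qed
    also have "\<dots> = ennreal (real (Suc n)) * (\<integral>\<^sup>+ x. ennreal (min 1 (norm x)) \<partial>\<nu>)"
      by (intro nn_integral_cmult) (simp add: measurable_cong_sets[OF sets refl])
    also have "\<dots> < \<infinity>"
      using fin by (simp add: ennreal_mult_less_top)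
    finally show ?thesis .
  qed
  have "x \<in> insert 0 (\<Union>n. A n)" for x
  proof (cases "x = 0")
    case False
    then obtain n where "1 / real (Suc n) < norm x"
      using nat_approx_posE[where e = "norm x"] by (metis zero_less_norm_iff)
    then show ?thesis
      by (auto simp: A_def intro!: exI[of _ n])
  qed simp
  then have "\<Union>(insert {0} (range A)) = space \<nu>"
    unfolding sp by auto
  moreover have "insert {0} (range A) \<subseteq> sets \<nu>"
    using meas by (auto simp: sets)
  moreover have "\<forall>a\<in>insert {0} (range A). emeasure \<nu> a \<noteq> \<infinity>"
    using A_fin zero by (auto simp: less_top)
  ultimately show "\<exists>B. countable B \<and> B \<subseteq> sets \<nu> \<and> \<Union>B = space \<nu> \<and> (\<forall>a\<in>B. emeasure \<nu> a \<noteq> \<infinity>)"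
    by (intro exI[of _ "insert {0} (range A)"]) auto
qed

text \<open>A jump by \<open>x\<close> leads from \<open>y\<close> inside the superlevel set to a
  point outside exactly when \<open>u (x + y) \<le> t < u y\<close>. Read as a condition on
  \<open>t\<close>, this is membership in a half-open interval, ready for integration over
  \<open>t\<close>.\<close>

lemma nl_perimeter_superlevel:
  fixes \<nu> :: "(real ^ 'd) measure"
  assumes sets: "sets \<nu> = sets borel" and u: "u \<in> borel_measurable borel"
  shows "nl_perimeter \<nu> (superlevel u t)
    = (\<integral>\<^sup>+ y. (\<integral>\<^sup>+ x. indicator {u (x + y)..<u y} t \<partial>\<nu>) \<partial>lborel)"
  unfolding nl_perimeter_def
proof (intro nn_integral_cong)
  fix y
  let ?S = "superlevel u t"
  have S: "{z - y | z. z \<in> - ?S} = {x. u (x + y) \<le> t}"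
    by (force simp: superlevel_def not_less intro: exI[of _ "_ + y"])
  have "{x. u (x + y) \<le> t} \<in> sets \<nu>"
    unfolding sets using u by measurable
  then have "emeasure \<nu> {z - y | z. z \<in> - ?S} * indicator ?S y
      = (\<integral>\<^sup>+ x. indicator {x. u (x + y) \<le> t} x * indicator ?S y \<partial>\<nu>)"
    unfolding S by (simp add: nn_integral_multc)
  also have "\<dots> = (\<integral>\<^sup>+ x. indicator {u (x + y)..<u y} t \<partial>\<nu>)"
    by (intro nn_integral_cong) (auto simp: superlevel_def indicator_def)
  finally show "emeasure \<nu> {z - y | z. z \<in> - ?S} * indicator ?S y
      = (\<integral>\<^sup>+ x. indicator {u (x + y)..<u y} t \<partial>\<nu>)" .
qed

theorem proposition2p7:
  fixes \<nu> :: "(real ^ 'd) measure" and u :: "real ^ 'd \<Rightarrow> real"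
  assumes "sets \<nu> = sets borel"
    and "(\<integral>\<^sup>+ x. ennreal (min 1 (norm x)) \<partial>\<nu>) < \<infinity>"
    and "emeasure \<nu> {0} = 0"
    and "integrable lborel u"
  shows "nl_variation \<nu> u = (\<integral>\<^sup>+ t. nl_perimeter \<nu> (superlevel u t) \<partial>lborel)"
proof -
  note [measurable_cong] = assms(1)
  have u [measurable]: "u \<in> borel_measurable borel"
    using assms(4) by (auto dest: borel_measurable_integrable)
  interpret N: sigma_finite_measure \<nu>
    using assms by (intro sigma_finite_if_min_norm_integrable)
  interpret LN: pair_sigma_finite "lborel :: (real ^ 'd) measure" \<nu> ..
  interpret TN: pair_sigma_finite "lborel :: real measure" \<nu> ..
  let ?P = "\<integral>\<^sup>+ y. (\<integral>\<^sup>+ x. ennreal (u y - u (x + y)) \<partial>\<nu>) \<partial>lborel"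
  let ?Q = "\<integral>\<^sup>+ y. (\<integral>\<^sup>+ x. ennreal (u (x + y) - u y) \<partial>\<nu>) \<partial>lborel"

  have "(\<integral>\<^sup>+ t. nl_perimeter \<nu> (superlevel u t) \<partial>lborel)
      = (\<integral>\<^sup>+ t. (\<integral>\<^sup>+ y. (\<integral>\<^sup>+ x. indicator {u (x + y)..<u y} t \<partial>\<nu>) \<partial>lborel) \<partial>lborel)"
    by (simp add: nl_perimeter_superlevel assms(1) u)
  \<comment> \<open>The \<open>t\<close>-integral moves innermost in two swaps: first past
    \<open>y\<close>, then past \<open>x\<close> with \<open>y\<close> fixed. Unfolding the
    indicator reduces joint measurability to that of the two inequalities.\<close>
  also have "\<dots> = (\<integral>\<^sup>+ y. (\<integral>\<^sup>+ t. (\<integral>\<^sup>+ x. indicator {u (x + y)..<u y} t \<partial>\<nu>) \<partial>lborel) \<partial>lborel)"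
    by (rule lborel_pair.Fubini'[symmetric]) (simp add: indicator_def)
  also have "\<dots> = (\<integral>\<^sup>+ y. (\<integral>\<^sup>+ x. (\<integral>\<^sup>+ t. indicator {u (x + y)..<u y} t \<partial>lborel) \<partial>\<nu>) \<partial>lborel)"
    by (intro nn_integral_cong TN.Fubini'[symmetric]) (simp add: indicator_def)
  also have "\<dots> = ?P"
  proof (intro nn_integral_cong)
    fix x y
    show "(\<integral>\<^sup>+ t. indicator {u (x + y)..<u y} t \<partial>lborel) = ennreal (u y - u (x + y))"
      \<comment> \<open>In the other case the interval is empty and \<open>ennreal\<close> of the
        negative difference is \<open>0\<close>.\<close>
      by (cases "u (x + y) \<le> u y") (auto simp: ennreal_neg)
  qed
  finally have per: "(\<integral>\<^sup>+ t. nl_perimeter \<nu> (superlevel u t) \<partial>lborel) = ?P" .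

  \<comment> \<open>Translation invariance acts on \<open>y\<close> for a fixed shift
    \<open>x\<close>, so the Lebesgue integral has to be the inner one.\<close>
  have "?P = (\<integral>\<^sup>+ x. (\<integral>\<^sup>+ y. ennreal (u y - u (x + y)) \<partial>lborel) \<partial>\<nu>)"
    by (rule LN.Fubini'[symmetric]) simp
  also have "\<dots> = (\<integral>\<^sup>+ x. (\<integral>\<^sup>+ y. ennreal (u (x + y) - u y) \<partial>lborel) \<partial>\<nu>)"
    by (simp add: nn_integral_translation_diff_commute[OF assms(4)])
  also have "\<dots> = ?Q"
    by (rule LN.Fubini') simp
  finally have PQ: "?P = ?Q" .

  \<comment> \<open>At least one summand is truncated to \<open>0\<close>, and the other is the
    absolute value.\<close>
  have split: "ennreal \<bar>a - b\<bar> = ennreal (b - a) + ennreal (a - b)" for a b :: real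
    by (cases "a \<le> b") (auto simp: ennreal_neg)
  have "(\<integral>\<^sup>+ y. (\<integral>\<^sup>+ x. ennreal \<bar>u (x + y) - u y\<bar> \<partial>\<nu>) \<partial>lborel) = ?P + ?Q"
    unfolding split by (simp add: nn_integral_add)
  also have "\<dots> = ennreal 2 * ?P"
    unfolding PQ by (simp flip: mult_2)
  finally have "nl_variation \<nu> u = ennreal (1 / 2) * ennreal 2 * ?P"
    unfolding nl_variation_def by (simp only: mult.assoc)
  also have "ennreal (1 / 2) * ennreal 2 = 1"
    by (subst ennreal_mult[symmetric]) auto
  finally show ?thesis
    unfolding per by simp
qed

end
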